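(* There exists a universal constant $c>0$ (in particular independent of $\mathbf{M}$, of $J$, and of the eigenvalues of $\mathbf{T}$) such that for every integer $J\ge0$ the wavelet transform $\mathcal{W}^{(2)}_J=\{\Psi^{(2)}_j,\Phi^{(2)}_J\}_{0\le j\le J}$ satisfies, for all $\mathbf{x}\in\mathbf{L}^2(\mathbf{M})$, $$c\,\|\mathbf{x}\|_{\mathbf{M}}^2\le\big\|\mathcal{W}^{(2)}_J\mathbf{x}\big\|_{\mathbf{M}}^2:=\sum_{j=0}^{J}\big\|\Psi^{(2)}_j\mathbf{x}\big\|_{\mathbf{M}}^2+\big\|\Phi^{(2)}_J\mathbf{x}\big\|_{\mathbf{M}}^2\le\|\mathbf{x}\|_{\mathbf{M}}^2 .$$
   Context: Let $G=(V,E,W)$ be a weighted, connected (undirected) graph with vertices $\{0,\dots,n-1\}$, weighted adjacency matrix $\mathbf{A}$, weighted degree vector $\mathbf{d}$, and $\mathbf{D}=\mathrm{diag}(\mathbf{d})$. Let $\mathbf{N}=\mathbf{I}-\mathbf{D}^{-1/2}\mathbf{A}\mathbf{D}^{-1/2}$ have eigenvalues $0=\omega_0<\omega_1\le\dots\le\omega_{n-1}\le 2$ and orthonormal eigenbasis $\mathbf{v}_0,\dots,\mathbf{v}_{n-1}$ of $\mathbb{R}^n$, $\mathbf{N}\mathbf{v}_i=\omega_i\mathbf{v}_i$, and let $\mathbf{V}$ be the orthogonal matrix with columns $\mathbf{v}_i$. Let $g:[0,2]\to[0,1]$ be a monotonically decreasing function with $g(0)=1$, $g(2)=0$; put $\lambda_i=g(\omega_i)$,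 so $1=\lambda_0>\lambda_1\ge\dots\ge\lambda_{n-1}\ge 0$, $\Lambda=\mathrm{diag}(\lambda_0,\dots,\lambda_{n-1})$ and $\mathbf{T}=\mathbf{V}\Lambda\mathbf{V}^T$. Let $\mathbf{M}$ be an invertible real $n\times n$ matrix and $\mathbf{K}=\mathbf{M}^{-1}\mathbf{T}\mathbf{M}$. $\mathbf{L}^2(\mathbf{M})$ is $\mathbb{R}^n$ with inner product $\langle\mathbf{x},\mathbf{y}\rangle_{\mathbf{M}}=\langle\mathbf{M}\mathbf{x},\mathbf{M}\mathbf{y}\rangle_2$ and norm $\|\mathbf{x}\|_{\mathbf{M}}=\|\mathbf{M}\mathbf{x}\|_2$. For $J\ge0$ let $p_0(t)=1-t$, $p_j(t)=t^{2^{j-1}}-t^{2^j}$ for $1\le j\le J$, and $p_{J+1}(t)=t^{2^J}$. Set $\Psi^{(2)}_j=p_j(\mathbf{K})$ for $0\le j\le J$ and $\Phi^{(2)}_J=p_{J+1}(\mathbf{K})$. *)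

theory Defs
  imports
    "Jordan_Normal_Form.Gauss_Jordan_Elimination"
    "Graph_Theory.Graph_Theory"
    Complex_Main
    "HOL-Computational_Algebra.Polynomial"
begin

text \<open>
  An undirected graph is a symmetric pair digraph. Loops are not excluded, so that both conventions
  for \<open>graph\<close> are covered. Positivity and symmetry of the weights are only required on the edges;
  elsewhere the weight function is irrelevant.
\<close>

definition connected_weighted_graph ::
    "nat \<Rightarrow> nat pair_pre_digraph \<Rightarrow> (nat \<times> nat \<Rightarrow> real) \<Rightarrow> bool" where
  "connected_weighted_graph n G w \<longleftrightarrow>
     pair_pseudo_graph G \<and> pverts G = {0..<n} \<and> Digraph_Component.connected (with_proj G) \<and>
     (\<forall>(i, j) \<in> parcs G. 0 < w (i, j) \<and> w (i, j) = w (j, i))"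

definition weighted_adjacency ::
    "nat \<Rightarrow> nat pair_pre_digraph \<Rightarrow> (nat \<times> nat \<Rightarrow> real) \<Rightarrow> real mat" where
  "weighted_adjacency n G w = mat n n (\<lambda>(i, j). if (i, j) \<in> parcs G then w (i, j) else 0)"

definition weighted_degree ::
    "nat \<Rightarrow> nat pair_pre_digraph \<Rightarrow> (nat \<times> nat \<Rightarrow> real) \<Rightarrow> real vec" where
  "weighted_degree n G w = vec n (\<lambda>i. \<Sum>j<n. weighted_adjacency n G w $$ (i, j))"

text \<open>
  A connected graph with at least two vertices has positive degrees. The only degenerate case is a
  single vertex without a loop, where \<open>1 / sqrt 0 = 0\<close>.
\<close>

definition normalized_laplacian ::
    "nat \<Rightarrow> nat pair_pre_digraph \<Rightarrow> (nat \<times> nat \<Rightarrow> real) \<Rightarrow> real mat" where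
  "normalized_laplacian n G w =
     (let D' = mat_diag n (\<lambda>i. 1 / sqrt (weighted_degree n G w $ i))
      in 1\<^sub>m n - D' * weighted_adjacency n G w * D')"

text \<open>
  The numbering of the eigenvalues is increasing. That they lie in \<open>[0, 2]\<close>, and that the eigenvalue
  \<open>0\<close> is attained and simple, follows from connectedness (if \<open>n \<ge> 2\<close>) and is not assumed.
\<close>

definition orthonormal_eigenbasis ::
    "nat \<Rightarrow> real mat \<Rightarrow> (nat \<Rightarrow> real) \<Rightarrow> (nat \<Rightarrow> real vec) \<Rightarrow> bool" where
  "orthonormal_eigenbasis n N \<omega> v \<longleftrightarrow>
     mono_on {0..<n} \<omega> \<and>
     (\<forall>i<n. v i \<in> carrier_vec n \<and> N *\<^sub>v v i = \<omega> i \<cdot>\<^sub>v v i) \<and>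
     (\<forall>i<n. \<forall>j<n. v i \<bullet> v j = (if i = j then 1 else 0))"

definition spectral_response :: "(real \<Rightarrow> real) \<Rightarrow> bool" where
  "spectral_response g \<longleftrightarrow>
     g ` {0..2} \<subseteq> {0..1} \<and> antimono_on {0..2} g \<and> g 0 = 1 \<and> g 2 = 0"

definition diffusion_T ::
    "nat \<Rightarrow> (real \<Rightarrow> real) \<Rightarrow> (nat \<Rightarrow> real) \<Rightarrow> (nat \<Rightarrow> real vec) \<Rightarrow> real mat" where
  "diffusion_T n g \<omega> v =
     (let V = mat_of_cols n (map v [0..<n])
      in V * mat_diag n (\<lambda>i. g (\<omega> i)) * transpose_mat V)"

definition diffusion_K :: "real mat \<Rightarrow> real mat \<Rightarrow> real mat" where
  "diffusion_K M T = the (mat_inverse M) * T * M"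

definition inner_M :: "real mat \<Rightarrow> real vec \<Rightarrow> real vec \<Rightarrow> real" where
  "inner_M M x y = (M *\<^sub>v x) \<bullet> (M *\<^sub>v y)"

definition norm_M :: "real mat \<Rightarrow> real vec \<Rightarrow> real" where
  "norm_M M x = sqrt (inner_M M x x)"

text \<open>
  The value \<open>p(A)\<close> of a polynomial at a square matrix. The sum is taken entrywise because the type of
  matrices of arbitrary size has no zero element, hence no big operator.
\<close>

definition mat_poly :: "real poly \<Rightarrow> real mat \<Rightarrow> real mat" where
  "mat_poly p A = mat (dim_row A) (dim_row A)
     (\<lambda>ij. \<Sum>k\<le>degree p. coeff p k * (A ^\<^sub>m k) $$ ij)"

definition wavelet_poly :: "nat \<Rightarrow> nat \<Rightarrow> real poly" where
  "wavelet_poly J j =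
     (if j = 0 then 1 - monom 1 1
      else if j \<le> J then monom 1 (2 ^ (j - 1)) - monom 1 (2 ^ j)
      else monom 1 (2 ^ J))"

definition wavelet_Psi :: "nat \<Rightarrow> real mat \<Rightarrow> nat \<Rightarrow> real mat" where
  "wavelet_Psi J K j = mat_poly (wavelet_poly J j) K"

definition wavelet_Phi :: "nat \<Rightarrow> real mat \<Rightarrow> real mat" where
  "wavelet_Phi J K = mat_poly (wavelet_poly J (J + 1)) K"

definition wavelet_transform_norm_sq :: "real mat \<Rightarrow> nat \<Rightarrow> real mat \<Rightarrow> real vec \<Rightarrow> real" where
  "wavelet_transform_norm_sq M J K x =
     (\<Sum>j=0..J. (norm_M M (wavelet_Psi J K j *\<^sub>v x))\<^sup>2) + (norm_M M (wavelet_Phi J K *\<^sub>v x))\<^sup>2"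

end

theory Submission
  imports Defs "Jordan_Normal_Form.Determinant"
begin

text \<open>
  The rows of \<open>U = V\<^sup>T M\<close> diagonalise \<open>K\<close>, that is \<open>U K = \<Lambda> U\<close>, and \<open>\<parallel>x\<parallel>\<^sub>M = \<parallel>U x\<parallel>\<^sub>2\<close> because \<open>V\<close> is
  orthogonal. In these coordinates \<open>\<parallel>W x\<parallel>\<^sup>2\<close> is the sum of \<open>(U x)\<^sub>i\<^sup>2 * (\<Sum>j. p\<^sub>j(\<lambda>\<^sub>i)\<^sup>2)\<close>, so everything
  reduces to bounding \<open>\<Sum>j. p\<^sub>j(t)\<^sup>2\<close> for \<open>t \<in> [0, 1]\<close>. The \<open>p\<^sub>j(t)\<close> are nonnegative with sum \<open>1\<close>, which
  gives the upper bound \<open>1\<close>. For the lower bound, follow the powers \<open>t\<close>, \<open>t\<^sup>2\<close>, \<open>t\<^sup>4\<close>, and so on until they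
  drop below \<open>1/2\<close>: at that step \<open>s - s\<^sup>2\<close> is bounded away from \<open>0\<close>; if they never
  do, the low-pass term is at least \<open>1/2\<close>.
\<close>

section \<open>Scalar bounds for the filters on [0, 1]\<close>

lemma poly_wavelet_poly_nonneg:
  assumes "0 \<le> t" "t \<le> 1"
  shows "0 \<le> poly (wavelet_poly J j) t"
  using assms by (auto simp: wavelet_poly_def poly_monom intro: power_decreasing)

lemma poly_wavelet_poly_power:
  "poly (wavelet_poly J (Suc j)) t = t ^ 2 ^ j - (t ^ 2 ^ j)\<^sup>2" if "j < J"
  using that by (simp add: wavelet_poly_def poly_monom power_mult[symmetric] mult.commute)

lemma sum_poly_wavelet_poly:
  "(\<Sum>j=0..Suc J. poly (wavelet_poly J j) t) = 1"
proof -
  \<comment> \<open>The sum telescopes. The bound \<open>m \<le> J\<close> keeps the partial sums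
    among the band-pass filters; the low-pass filter at index \<open>Suc J\<close> supplies the
    missing \<open>t ^ 2 ^ J\<close>.\<close>
  have "(\<Sum>j=0..m. poly (wavelet_poly J j) t) = 1 - t ^ 2 ^ m" if "m \<le> J" for m
    using that by (induction m) (auto simp: wavelet_poly_def poly_monom)
  from this[of J] show ?thesis
    by (simp add: wavelet_poly_def poly_monom)
qed

lemma sum_poly_wavelet_poly_sq_le:
  assumes "0 \<le> t" "t \<le> 1"
  shows "(\<Sum>j=0..Suc J. (poly (wavelet_poly J j) t)\<^sup>2) \<le> 1"
proof -
  let ?p = "\<lambda>j. poly (wavelet_poly J j) t"
  \<comment> \<open>A nonnegative summand is at most the total 1, and squaring shrinks numbers in
    [0, 1].\<close>
  have "(\<Sum>j=0..Suc J. (?p j)\<^sup>2) \<le> (\<Sum>j=0..Suc J. ?p j)"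
  proof (rule sum_mono)
    fix j assume "j \<in> {0..Suc J}"
    then have "?p j \<le> (\<Sum>j=0..Suc J. ?p j)"
      using assms by (intro member_le_sum) (auto intro: poly_wavelet_poly_nonneg)
    then have "?p j \<le> 1"
      by (simp only: sum_poly_wavelet_poly)
    then show "(?p j)\<^sup>2 \<le> ?p j"
      using poly_wavelet_poly_nonneg[OF assms] by (simp add: power2_eq_square mult_left_le)
  qed
  then show ?thesis
    by (simp only: sum_poly_wavelet_poly)
qed

text \<open>Induction on the number of filters inspected: either one of them is already at least
  1/8, or the current power of \<open>t\<close> is still at least 1/2. The second alternative,
  carried up to \<open>J\<close>, makes the low-pass filter large.\<close>

lemma poly_wavelet_poly_large:
  assumes "0 \<le> t" "t \<le> 1"
  shows "\<exists>j\<le>Suc J. 1/8 \<le> poly (wavelet_poly J j) t"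
proof -
  have "(\<exists>j\<le>m. 1/8 \<le> poly (wavelet_poly J j) t) \<or> 1/2 \<le> t ^ 2 ^ m" if "m \<le> J" for m
    using that
  proof (induction m)
    case 0
    have "poly (wavelet_poly J 0) t = 1 - t"
      by (simp add: wavelet_poly_def poly_monom)
    then show ?case by auto
  next
    case (Suc m)
    define s where "s = t ^ 2 ^ m"
    have s1: "s \<le> 1"
      using assms by (simp add: s_def power_le_one)
    have sq: "t ^ 2 ^ Suc m = s\<^sup>2"
      by (simp add: s_def power_mult[symmetric] mult.commute)
    have p: "poly (wavelet_poly J (Suc m)) t = s - s\<^sup>2"
      using Suc.prems by (simp add: s_def poly_wavelet_poly_power)
    \<comment> \<open>Above 3/4 the square still exceeds 1/2. Between 1/2 and 3/4 the factors of s
      (1 - s) are at least 1/2 and 1/4, which is where 1/8 comes from.\<close>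
    have "1/2 \<le> s\<^sup>2 \<or> 1/8 \<le> s - s\<^sup>2" if "1/2 \<le> s"
    proof (cases "s \<le> 3/4")
      case True
      then have "1/2 * (1/4) \<le> s * (1 - s)"
        using that by (intro mult_mono) auto
      then show ?thesis
        by (simp add: power2_eq_square algebra_simps)
    next
      case False
      then have "3/4 * (3/4) \<le> s * s"
        by (intro mult_mono) auto
      then show ?thesis
        by (simp add: power2_eq_square)
    qed
    moreover have "(\<exists>j\<le>m. 1/8 \<le> poly (wavelet_poly J j) t) \<or> 1/2 \<le> s"
      using Suc unfolding s_def by simp
    ultimately show ?case
      unfolding sq using p by (metis le_SucI order_refl)
  qed
  from this[OF order_refl] show ?thesis
  proof (elim disjE exE conjE)
    assume "1/2 \<le> t ^ 2 ^ J"
    then show ?thesis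
      by (intro exI[of _ "Suc J"]) (simp add: wavelet_poly_def poly_monom)
  qed (auto intro: le_SucI)
qed

lemma sum_poly_wavelet_poly_sq_ge:
  assumes "0 \<le> t" "t \<le> 1"
  shows "1/64 \<le> (\<Sum>j=0..Suc J. (poly (wavelet_poly J j) t)\<^sup>2)"
proof -
  obtain j where j: "j \<le> Suc J" "1/8 \<le> poly (wavelet_poly J j) t"
    using poly_wavelet_poly_large[OF assms] by blast
  \<comment> \<open>All summands are squares, so the single large one gives the bound 1/64.\<close>
  have "(1/8)\<^sup>2 \<le> (poly (wavelet_poly J j) t)\<^sup>2"
    using j(2) by (intro power_mono) auto
  also have "\<dots> \<le> (\<Sum>j=0..Suc J. (poly (wavelet_poly J j) t)\<^sup>2)"
    using j(1) by (intro member_le_sum) auto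
  finally show ?thesis
    by (simp add: power2_eq_square)
qed

section \<open>The spectrum of the normalized Laplacian\<close>

lemma quadratic_form_diagonally_dominated:
  fixes a :: "nat \<Rightarrow> nat \<Rightarrow> real" and u :: "nat \<Rightarrow> real"
  assumes nonneg: "\<And>i j. i < n \<Longrightarrow> j < n \<Longrightarrow> 0 \<le> a i j"
    and sym: "\<And>i j. i < n \<Longrightarrow> j < n \<Longrightarrow> a i j = a j i"
  shows "\<bar>\<Sum>i<n. \<Sum>j<n. a i j * (u i * u j)\<bar> \<le> (\<Sum>i<n. (\<Sum>j<n. a i j) * (u i)\<^sup>2)"
proof -
  \<comment> \<open>The inequality 2 |pq| \<le> p^2 + q^2 shares each cross term equally between its
    two indices; by symmetry of \<open>a\<close> the two halves have the same sum.\<close>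
  have le: "\<bar>a i j * (u i * u j)\<bar> \<le> a i j * (u i)\<^sup>2 / 2 + a i j * (u j)\<^sup>2 / 2" if "i < n" "j < n" for i j
  proof -
    have "2 * \<bar>u i * u j\<bar> \<le> (u i)\<^sup>2 + (u j)\<^sup>2"
      using sum_squares_bound[of "\<bar>u i\<bar>" "\<bar>u j\<bar>"] by (simp add: abs_mult mult.assoc)
    then have "a i j * \<bar>u i * u j\<bar> \<le> a i j * (((u i)\<^sup>2 + (u j)\<^sup>2) / 2)"
      using nonneg[OF that] by (intro mult_left_mono) auto
    then show ?thesis
      using nonneg[OF that] by (simp add: abs_mult algebra_simps add_divide_distrib)
  qed
  have "\<bar>\<Sum>i<n. \<Sum>j<n. a i j * (u i * u j)\<bar> \<le> (\<Sum>i<n. \<Sum>j<n. \<bar>a i j * (u i * u j)\<bar>)"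
    by (rule order_trans[OF sum_abs sum_mono[OF sum_abs]])
  also have "\<dots> \<le> (\<Sum>i<n. \<Sum>j<n. a i j * (u i)\<^sup>2 / 2 + a i j * (u j)\<^sup>2 / 2)"
    using le by (intro sum_mono) auto
  also have "\<dots> = (\<Sum>i<n. \<Sum>j<n. a i j * (u i)\<^sup>2 / 2) + (\<Sum>i<n. \<Sum>j<n. a i j * (u j)\<^sup>2 / 2)"
    by (simp add: sum.distrib)
  also have "(\<Sum>i<n. \<Sum>j<n. a i j * (u j)\<^sup>2 / 2) = (\<Sum>i<n. \<Sum>j<n. a i j * (u i)\<^sup>2 / 2)"
    using sym by (subst sum.swap) (auto intro!: sum.cong)
  also have "(\<Sum>i<n. \<Sum>j<n. a i j * (u i)\<^sup>2 / 2) + (\<Sum>i<n. \<Sum>j<n. a i j * (u i)\<^sup>2 / 2)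
      = (\<Sum>i<n. (\<Sum>j<n. a i j) * (u i)\<^sup>2)"
    by (simp add: sum_distrib_right flip: sum_divide_distrib)
  finally show ?thesis .
qed

text \<open>With u = D^(-1/2) x, the Rayleigh quotient gives 1 - \<mu> = u^T A u, and diagonal
  domination yields |u^T A u| \<le> u^T D u \<le> x^T x = 1. This places the eigenvalues where
  \<open>g\<close> is controlled.\<close>

lemma normalized_laplacian_eigenvalue:
  assumes G: "connected_weighted_graph n G w"
    and x: "x \<in> carrier_vec n" "normalized_laplacian n G w *\<^sub>v x = \<mu> \<cdot>\<^sub>v x" "x \<bullet> x = 1"
  shows "0 \<le> \<mu>" "\<mu> \<le> 2"
proof -
  define A where "A = weighted_adjacency n G w"
  define a where "a i j = A $$ (i, j)" for i j
  define d where "d = weighted_degree n G w"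
  define r where "r i = 1 / sqrt (d $ i)" for i
  define u where "u i = r i * x $ i" for i
  have A: "A \<in> carrier_mat n n"
    by (simp add: A_def weighted_adjacency_def)
  interpret pair_pseudo_graph G
    using G by (simp add: connected_weighted_graph_def)
  have nonneg: "0 \<le> a i j" if "i < n" "j < n" for i j
    using G that by (auto simp: a_def A_def weighted_adjacency_def connected_weighted_graph_def
        less_imp_le)
  have sym: "a i j = a j i" if "i < n" "j < n" for i j
    using G that arcs_symmetric
    by (auto simp: a_def A_def weighted_adjacency_def connected_weighted_graph_def)
  have d: "d $ i = (\<Sum>j<n. a i j)" if "i < n" for i
    using that by (simp add: d_def weighted_degree_def a_def A_def)
  have N: "normalized_laplacian n G w = mat n n (\<lambda>(i, j). (if i = j then 1 else 0) - r i * a i j * r j)"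
    unfolding normalized_laplacian_def Let_def d_def[symmetric] A_def[symmetric] r_def[symmetric]
    using A by (subst mat_diag_mult_left, simp, subst mat_diag_mult_right, simp)
      (auto simp: a_def)
  have "\<mu> * x $ i = x $ i - (\<Sum>j<n. r i * a i j * u j)" if i: "i < n" for i
  proof -
    have "\<mu> * x $ i = (normalized_laplacian n G w *\<^sub>v x) $ i"
      using x i by simp
    also have "\<dots> = (\<Sum>j<n. ((if i = j then 1 else 0) - r i * a i j * r j) * x $ j)"
      using x(1) i by (simp add: N scalar_prod_def atLeast0LessThan)
    also have "\<dots> = (\<Sum>j<n. (if j = i then x $ i else 0) - r i * a i j * u j)"
      by (intro sum.cong) (auto simp: u_def algebra_simps)
    finally show ?thesis
      using i by (simp add: sum_subtractf)
  qed
  \<comment> \<open>Pairing the eigenvalue equation with the unit vector \<open>x\<close> isolates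
    \<mu>.\<close>
  then have "(\<Sum>i<n. x $ i * (\<mu> * x $ i)) = (\<Sum>i<n. x $ i * (x $ i - (\<Sum>j<n. r i * a i j * u j)))"
    by (intro sum.cong) auto
  moreover have xx: "(\<Sum>i<n. x $ i * x $ i) = 1"
    using x(1,3) by (simp add: scalar_prod_def atLeast0LessThan)
  moreover have "(\<Sum>i<n. x $ i * (\<mu> * x $ i)) = \<mu> * (\<Sum>i<n. x $ i * x $ i)"
    by (simp add: sum_distrib_left algebra_simps)
  moreover have "(\<Sum>i<n. x $ i * (x $ i - (\<Sum>j<n. r i * a i j * u j)))
      = (\<Sum>i<n. x $ i * x $ i) - (\<Sum>i<n. \<Sum>j<n. a i j * (u i * u j))"
    by (simp add: right_diff_distrib sum_subtractf sum_distrib_left u_def mult_ac)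
  ultimately have \<mu>: "\<mu> = 1 - (\<Sum>i<n. \<Sum>j<n. a i j * (u i * u j))"
    by simp
  have "\<bar>\<Sum>i<n. \<Sum>j<n. a i j * (u i * u j)\<bar> \<le> (\<Sum>i<n. (\<Sum>j<n. a i j) * (u i)\<^sup>2)"
    using nonneg sym by (rule quadratic_form_diagonally_dominated)
  also have "\<dots> \<le> (\<Sum>i<n. x $ i * x $ i)"
  proof (rule sum_mono)
    fix i assume "i \<in> {..<n}"
    then have i: "i < n" by simp
    have "0 \<le> d $ i"
      unfolding d[OF i] using nonneg i by (intro sum_nonneg) auto
    \<comment> \<open>For positive degree this is an equality; for degree zero the left side
      vanishes.\<close>
    then have "d $ i * (u i)\<^sup>2 \<le> x $ i * x $ i"
      by (cases "d $ i = 0") (auto simp: u_def r_def power_mult_distrib power_divide power2_eq_square)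
    then show "(\<Sum>j<n. a i j) * (u i)\<^sup>2 \<le> x $ i * x $ i"
      using d[OF i] by simp
  qed
  finally have "\<bar>\<Sum>i<n. \<Sum>j<n. a i j * (u i * u j)\<bar> \<le> 1"
    using xx by simp
  then show "0 \<le> \<mu>" "\<mu> \<le> 2"
    using \<mu> by linarith+
qed

section \<open>Matrix polynomials and diagonalisation\<close>

lemma mat_poly_carrier: "A \<in> carrier_mat n n \<Longrightarrow> mat_poly p A \<in> carrier_mat n n"
  by (auto simp: mat_poly_def)

text \<open>The intertwining relation passes to powers by moving one factor \<open>A\<close> across
  at a time, and to polynomials by linearity. In this form it involves no inverse of
  \<open>B\<close>.\<close>

lemma mult_mat_poly_diagonalised:
  assumes A: "A \<in> carrier_mat n n" and B: "B \<in> carrier_mat n n"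
    and BA: "B * A = mat_diag n l * B"
  shows "B * mat_poly p A = mat_diag n (\<lambda>i. poly p (l i)) * B"
proof -
  have pow: "B * A ^\<^sub>m k = mat_diag n (\<lambda>i. l i ^ k) * B" for k
  proof (induction k)
    case 0
    show ?case using A B by simp
  next
    case (Suc k)
    have "B * A ^\<^sub>m Suc k = B * A ^\<^sub>m k * A"
      using A B by (simp add: assoc_mult_mat[of _ n n _ n _ n])
    also have "\<dots> = mat_diag n (\<lambda>i. l i ^ k) * (B * A)"
      unfolding Suc using A B by (simp add: assoc_mult_mat[of _ n n _ n _ n])
    also have "\<dots> = mat_diag n (\<lambda>i. l i ^ k) * mat_diag n l * B"
      unfolding BA using B by (simp add: assoc_mult_mat[of _ n n _ n _ n] del: mat_diag_diag)
    finally show ?case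
      by (simp add: mult.commute)
  qed
  show ?thesis
  proof (rule eq_matI)
    fix i j assume "i < dim_row (mat_diag n (\<lambda>i. poly p (l i)) * B)"
      "j < dim_col (mat_diag n (\<lambda>i. poly p (l i)) * B)"
    then have ij: "i < n" "j < n"
      using B by (auto simp: mat_diag_def)
    have entry: "(\<Sum>m<n. B $$ (i, m) * (A ^\<^sub>m k) $$ (m, j)) = l i ^ k * B $$ (i, j)" for k
    proof -
      have "(\<Sum>m<n. B $$ (i, m) * (A ^\<^sub>m k) $$ (m, j)) = (B * A ^\<^sub>m k) $$ (i, j)"
        using A B ij pow_carrier_mat[OF A, of k] by (simp add: scalar_prod_def atLeast0LessThan)
      then show ?thesis
        using ij B unfolding pow by (simp add: mat_diag_mult_left[OF B])
    qed
    \<comment> \<open>As \<open>mat_poly\<close> is defined entrywise, linearity becomes an exchange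
      of finite sums.\<close>
    have "(B * mat_poly p A) $$ (i, j)
        = (\<Sum>m<n. B $$ (i, m) * (\<Sum>k\<le>degree p. coeff p k * (A ^\<^sub>m k) $$ (m, j)))"
      using A B ij by (simp add: mat_poly_def scalar_prod_def atLeast0LessThan)
    also have "\<dots> = (\<Sum>k\<le>degree p. coeff p k * (\<Sum>m<n. B $$ (i, m) * (A ^\<^sub>m k) $$ (m, j)))"
      by (simp add: sum_distrib_left mult_ac) (rule sum.swap)
    also have "\<dots> = poly p (l i) * B $$ (i, j)"
      by (simp add: entry poly_altdef sum_distrib_left mult_ac)
    also have "\<dots> = (mat_diag n (\<lambda>i. poly p (l i)) * B) $$ (i, j)"
      using ij by (simp add: mat_diag_mult_left[OF B])
    finally show "(B * mat_poly p A) $$ (i, j) = (mat_diag n (\<lambda>i. poly p (l i)) * B) $$ (i, j)" .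
  qed (use A B in \<open>auto simp: mat_diag_def mat_poly_def\<close>)
qed

lemma mat_diag_mult_vec_index:
  assumes "y \<in> carrier_vec n" "i < n"
  shows "(mat_diag n l *\<^sub>v y) $ i = l i * (y $ i :: real)"
proof -
  have "(mat_diag n l *\<^sub>v y) $ i = (\<Sum>j<n. (if i = j then l j else 0) * y $ j)"
    using assms by (simp add: mat_diag_def scalar_prod_def atLeast0LessThan)
  also have "\<dots> = (\<Sum>j<n. if j = i then l i * y $ i else 0)"
    by (intro sum.cong) auto
  finally show ?thesis using assms by simp
qed

lemma mat_of_cols_orthonormal:
  assumes "\<forall>i<n. v i \<in> carrier_vec n"
    and "\<forall>i<n. \<forall>j<n. v i \<bullet> v j = (if i = j then 1 else 0)"
  defines "V \<equiv> mat_of_cols n (map v [0..<n])"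
  shows "transpose_mat V * V = 1\<^sub>m n"
proof (rule eq_matI)
  fix i j assume ij: "i < dim_row (1\<^sub>m n)" "j < dim_col (1\<^sub>m n)"
  then have "col V k = v k" if "k < n" for k
    using that assms(1) by (auto simp: V_def)
  then show "(transpose_mat V * V) $$ (i, j) = 1\<^sub>m n $$ (i, j)"
    using ij assms(2) by (simp add: V_def)
qed (simp_all add: V_def)

text \<open>\<open>invertible_mat\<close> yields an inverse of unspecified shape, whereas
  \<open>mat_inverse\<close> is characterised through units of the matrix ring. The two identity
  products force the inverse to be n by n, which connects the two notions.\<close>

lemma mat_inverse_invertible:
  fixes M :: "real mat"
  assumes M: "M \<in> carrier_mat n n" and inv: "invertible_mat M"
  shows "the (mat_inverse M) \<in> carrier_mat n n" "M * the (mat_inverse M) = 1\<^sub>m n"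
proof -
  obtain B where B: "M * B = 1\<^sub>m n" "B * M = 1\<^sub>m (dim_row B)"
    using inv M by (auto simp: invertible_mat_def inverts_mat_def)
  have "dim_col B = n"
    using arg_cong[OF B(1), of dim_col] by simp
  moreover have "dim_row B = n"
    using arg_cong[OF B(2), of dim_col] M by simp
  ultimately have Bc: "B \<in> carrier_mat n n" by auto
  then have "M \<in> Units (ring_mat TYPE(real) n undefined)"
    using B M by (auto simp: Units_def ring_mat_def)
  then have "mat_inverse M \<noteq> None"
    using mat_inverse(1)[OF M, where b = undefined] by blast
  then obtain C where "mat_inverse M = Some C" by blast
  then show "the (mat_inverse M) \<in> carrier_mat n n" "M * the (mat_inverse M) = 1\<^sub>m n"
    using mat_inverse(2)[OF M] by auto
qed

text \<open>In U K, first \<open>M\<close> cancels against its inverse and then V^T against V,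
  leaving the diagonal matrix times U. The norm identity is Parseval's identity for the orthonormal
  columns of V, applied to M x.\<close>

lemma diffusion_diagonalised:
  fixes M :: "real mat"
  assumes M: "M \<in> carrier_mat n n" "invertible_mat M"
    and v: "\<forall>i<n. v i \<in> carrier_vec n"
      "\<forall>i<n. \<forall>j<n. v i \<bullet> v j = (if i = j then 1 else 0)"
  obtains U where "U \<in> carrier_mat n n"
    and "diffusion_K M (diffusion_T n g \<omega> v) \<in> carrier_mat n n"
    and "U * diffusion_K M (diffusion_T n g \<omega> v) = mat_diag n (\<lambda>i. g (\<omega> i)) * U"
    and "\<And>x. x \<in> carrier_vec n \<Longrightarrow> (norm_M M x)\<^sup>2 = (\<Sum>i<n. ((U *\<^sub>v x) $ i)\<^sup>2)"
proof -
  define V where "V = mat_of_cols n (map v [0..<n])"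
  define L where "L = mat_diag n (\<lambda>i. g (\<omega> i))"
  define Mi where "Mi = the (mat_inverse M)"
  define U where "U = transpose_mat V * M"
  have V: "V \<in> carrier_mat n n" "transpose_mat V \<in> carrier_mat n n"
    by (auto simp: V_def)
  have L: "L \<in> carrier_mat n n" by (simp add: L_def)
  have VV: "transpose_mat V * V = 1\<^sub>m n"
    unfolding V_def by (rule mat_of_cols_orthonormal[OF v])
  have VV': "V * transpose_mat V = 1\<^sub>m n"
    by (rule mat_mult_left_right_inverse[OF V(2,1) VV])
  have Mi: "Mi \<in> carrier_mat n n" "M * Mi = 1\<^sub>m n"
    using mat_inverse_invertible[OF M] by (simp_all add: Mi_def)
  have K: "diffusion_K M (diffusion_T n g \<omega> v) = Mi * (V * (L * U))"
    using V L M Mi(1)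
    by (simp add: diffusion_K_def diffusion_T_def U_def assoc_mult_mat[of _ n n _ n _ n]
        flip: V_def L_def Mi_def)
  have U: "U \<in> carrier_mat n n"
    using V M by (simp add: U_def)
  have cancel: "X * (Y * Z) = Z"
    if "X * Y = 1\<^sub>m n" "X \<in> carrier_mat n n" "Y \<in> carrier_mat n n" "Z \<in> carrier_mat n n"
    for X Y Z :: "real mat"
    using that by (simp flip: assoc_mult_mat[of _ n n _ n _ n])
  have "U * (Mi * (V * (L * U))) = transpose_mat V * (M * (Mi * (V * (L * U))))"
    unfolding U_def using V L M Mi(1) by (simp add: assoc_mult_mat[of _ n n _ n _ n])
  also have "M * (Mi * (V * (L * U))) = V * (L * U)"
    using V L M Mi U by (intro cancel) auto
  also have "transpose_mat V * (V * (L * U)) = L * U"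
    using V L U VV by (intro cancel) auto
  finally have UK: "U * diffusion_K M (diffusion_T n g \<omega> v) = L * U"
    unfolding K .
  have norm: "(norm_M M x)\<^sup>2 = (\<Sum>i<n. ((U *\<^sub>v x) $ i)\<^sup>2)" if x: "x \<in> carrier_vec n" for x
  proof -
    define y where "y = M *\<^sub>v x"
    have y: "y \<in> carrier_vec n" using M x by (simp add: y_def)
    \<comment> \<open>Inserting V V^T = 1 and moving V to the other side shows that V^T preserves
      the Euclidean norm.\<close>
    have "y \<bullet> y = y \<bullet> ((V * transpose_mat V) *\<^sub>v y)"
      using y by (simp add: VV')
    also have "\<dots> = y \<bullet> (V *\<^sub>v (transpose_mat V *\<^sub>v y))"
      using V y by simp
    also have "\<dots> = (transpose_mat V *\<^sub>v y) \<bullet> (transpose_mat V *\<^sub>v y)"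
      using V y by (intro transpose_vec_mult_scalar[symmetric]) auto
    also have "transpose_mat V *\<^sub>v y = U *\<^sub>v x"
      using V M x by (simp add: U_def y_def)
    finally have "y \<bullet> y = (\<Sum>i<n. ((U *\<^sub>v x) $ i)\<^sup>2)"
      using U by (simp add: scalar_prod_def power2_eq_square atLeast0LessThan)
    moreover have "0 \<le> (\<Sum>i<n. ((U *\<^sub>v x) $ i)\<^sup>2)"
      by (simp add: sum_nonneg)
    ultimately show ?thesis
      by (simp add: norm_M_def inner_M_def y_def)
  qed
  show thesis
    using V L U Mi by (intro that[OF U _ UK[unfolded L_def] norm]) (simp add: K)
qed

section \<open>The transform in diagonal coordinates and the frame bounds\<close>

lemma wavelet_transform_norm_sq_diagonalised:
  assumes K: "K \<in> carrier_mat n n" and U: "U \<in> carrier_mat n n"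
    and UK: "U * K = mat_diag n l * U"
    and norm: "\<And>x. x \<in> carrier_vec n \<Longrightarrow> (norm_M M x)\<^sup>2 = (\<Sum>i<n. ((U *\<^sub>v x) $ i)\<^sup>2)"
    and x: "x \<in> carrier_vec n"
  shows "wavelet_transform_norm_sq M J K x =
    (\<Sum>i<n. (\<Sum>j=0..Suc J. (poly (wavelet_poly J j) (l i))\<^sup>2) * ((U *\<^sub>v x) $ i)\<^sup>2)"
proof -
  \<comment> \<open>Each filter only scales the coordinates of U x, so its squared norm has no cross
    terms.\<close>
  have one: "(norm_M M (mat_poly p K *\<^sub>v x))\<^sup>2 = (\<Sum>i<n. (poly p (l i))\<^sup>2 * ((U *\<^sub>v x) $ i)\<^sup>2)" for p
  proof -
    have "U *\<^sub>v (mat_poly p K *\<^sub>v x) = mat_diag n (\<lambda>i. poly p (l i)) *\<^sub>v (U *\<^sub>v x)"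
      using mult_mat_poly_diagonalised[OF K U UK, of p] K U x mat_poly_carrier[OF K, of p]
      by (metis assoc_mult_mat_vec mat_diag_dim)
    then have "(U *\<^sub>v (mat_poly p K *\<^sub>v x)) $ i = poly p (l i) * (U *\<^sub>v x) $ i" if "i < n" for i
      using that U x by (simp add: mat_diag_mult_vec_index[of _ n])
    then show ?thesis
      using x mat_poly_carrier[OF K, of p] by (subst norm) (auto simp: power_mult_distrib)
  qed
  \<comment> \<open>The low-pass term joins the sum as index \<open>Suc J\<close>.\<close>
  have "wavelet_transform_norm_sq M J K x
      = (\<Sum>j=0..Suc J. (norm_M M (mat_poly (wavelet_poly J j) K *\<^sub>v x))\<^sup>2)"
    by (simp add: wavelet_transform_norm_sq_def wavelet_Psi_def wavelet_Phi_def)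
  also have "\<dots> = (\<Sum>i<n. \<Sum>j=0..Suc J. (poly (wavelet_poly J j) (l i))\<^sup>2 * ((U *\<^sub>v x) $ i)\<^sup>2)"
    unfolding one by (rule sum.swap)
  finally show ?thesis
    by (simp only: sum_distrib_right)
qed

theorem proposition2p2:
  shows "\<exists>c::real. 0 < c \<and>
    (\<forall>(n::nat) (G :: nat pair_pre_digraph) (w :: nat \<times> nat \<Rightarrow> real)
       (\<omega> :: nat \<Rightarrow> real) (v :: nat \<Rightarrow> real vec) (g :: real \<Rightarrow> real) (M :: real mat).
       connected_weighted_graph n G w \<and>
       orthonormal_eigenbasis n (normalized_laplacian n G w) \<omega> v \<and>
       spectral_response g \<and>
       M \<in> carrier_mat n n \<and> invertible_mat M \<longrightarrow>
       (let K = diffusion_K M (diffusion_T n g \<omega> v) in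
        \<forall>(J::nat). \<forall>x \<in> carrier_vec n.
          c * (norm_M M x)\<^sup>2 \<le> wavelet_transform_norm_sq M J K x \<and>
          wavelet_transform_norm_sq M J K x \<le> (norm_M M x)\<^sup>2))"
\<comment> \<open>The witness 1/64 is the scalar lower bound, uniform in \<open>J\<close> and in the
  point of [0, 1], hence in all the data.\<close>
proof (intro exI[of _ "1/64"] conjI allI impI; (elim conjE)?)
  show "0 < (1/64 :: real)" by simp
next
  fix n G w \<omega> v g and M :: "real mat"
  assume G: "connected_weighted_graph n G w"
    and eig: "orthonormal_eigenbasis n (normalized_laplacian n G w) \<omega> v"
    and g: "spectral_response g"
    and M: "M \<in> carrier_mat n n" "invertible_mat M"
  define K where "K = diffusion_K M (diffusion_T n g \<omega> v)"
  have v: "\<forall>i<n. v i \<in> carrier_vec n"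
      "\<forall>i<n. \<forall>j<n. v i \<bullet> v j = (if i = j then 1 else 0)"
    using eig by (auto simp: orthonormal_eigenbasis_def)
  have l: "0 \<le> g (\<omega> i)" "g (\<omega> i) \<le> 1" if "i < n" for i
  proof -
    have "0 \<le> \<omega> i" "\<omega> i \<le> 2"
      using normalized_laplacian_eigenvalue[OF G, of "v i" "\<omega> i"] eig that
      by (auto simp: orthonormal_eigenbasis_def)
    then have "g (\<omega> i) \<in> {0..1}"
      using g unfolding spectral_response_def by (simp add: image_subset_iff)
    then show "0 \<le> g (\<omega> i)" "g (\<omega> i) \<le> 1" by auto
  qed
  obtain U where U: "U \<in> carrier_mat n n" and K: "K \<in> carrier_mat n n"
    and UK: "U * K = mat_diag n (\<lambda>i. g (\<omega> i)) * U"
    and norm: "\<And>x. x \<in> carrier_vec n \<Longrightarrow> (norm_M M x)\<^sup>2 = (\<Sum>i<n. ((U *\<^sub>v x) $ i)\<^sup>2)"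
    unfolding K_def using diffusion_diagonalised[OF M v] by blast
  have "1/64 * (norm_M M x)\<^sup>2 \<le> wavelet_transform_norm_sq M J K x \<and>
      wavelet_transform_norm_sq M J K x \<le> (norm_M M x)\<^sup>2" if x: "x \<in> carrier_vec n" for J x
  proof -
    let ?s = "\<lambda>i. \<Sum>j=0..Suc J. (poly (wavelet_poly J j) (g (\<omega> i)))\<^sup>2"
    let ?z = "\<lambda>i. ((U *\<^sub>v x) $ i)\<^sup>2"
    \<comment> \<open>The weights \<open>?z i\<close> are squares, so the scalar bounds at each
      g(\<omega>_i) can be summed against them.\<close>
    have "1/64 * (\<Sum>i<n. ?z i) \<le> (\<Sum>i<n. ?s i * ?z i)"
      unfolding sum_distrib_left
      using sum_poly_wavelet_poly_sq_ge l by (intro sum_mono mult_right_mono) auto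
    moreover have "(\<Sum>i<n. ?s i * ?z i) \<le> (\<Sum>i<n. 1 * ?z i)"
      using sum_poly_wavelet_poly_sq_le l by (intro sum_mono mult_right_mono) auto
    moreover have "wavelet_transform_norm_sq M J K x = (\<Sum>i<n. ?s i * ?z i)"
      using K U UK norm x by (rule wavelet_transform_norm_sq_diagonalised)
    ultimately show ?thesis
      using norm[OF x] by simp
  qed
  then show "let K = diffusion_K M (diffusion_T n g \<omega> v) in
        \<forall>(J::nat). \<forall>x \<in> carrier_vec n.
          1/64 * (norm_M M x)\<^sup>2 \<le> wavelet_transform_norm_sq M J K x \<and>
          wavelet_transform_norm_sq M J K x \<le> (norm_M M x)\<^sup>2"
    unfolding Let_def K_def by blast
qed

end
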